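(* Let $I$ be an index set. For each $i\in I$, let $X_i$ be a nonempty convex subset of a Hausdorff locally convex topological vector space $E_i$, let $D_i$ be a nonempty compact convex subset of $X_i$, put $X:=\prod_{i\in I}X_i$, and let $S_i,T_i:X\rightrightarrows X_i$ be two set valued maps such that: 1) for each $x\in X$, $\overline{S_i}(x)\subseteq T_i(x)$; 2) $S_i$ is almost w-upper semicontinuous with respect to $D_i$, and $\overline{S_i^{V_i}}$ has nonempty convex values for each absolutely convex symmetric neighborhood $V_i$ of $0$ in $E_i$. Then there exists $x^{*}\in D:=\prod_{i\in I}D_i$ such that $x_i^{*}\in T_i(x^{*})$ for each $i\in I$.
   Context: A set valued map $T:X\rightrightarrows Y$ assigns to each $x\in X$ a (possibly empty) subset $T(x)\subseteq Y$; its graph is $\mathrm{Gr}(T)=\{(x,y)\in X\times Y: y\in T(x)\}$. For topological spaces $X,Y$, the map $\overline{T}:X\rightrightarrows Y$ is defined by $\overline{T}(x):=\{y\in Y:(x,y)\in \mathrm{cl}_{X\times Y}\mathrm{Gr}(T)\}$. $T$ is upper semicontinuous if for each $x\in X$ and each open $V\subseteq Y$ with $T(x)\subseteq V$ there is an open neighborhood $U$ of $x$ with $T(y)\subseteq V$ for all $y\in U$. Let $X$ be a topological space, $Y$ a nonempty subset of a topological vector space $E$, $D\subseteq Y$, and $T:X\rightrightarrows Y$. For a neighborhood $V$ of $0$ in $E$, $T^{V}:X\rightrightarrows Y$ is defined by $T^{V}(x):=(T(x)+V)\cap D$; here $S_i^{V_i}(x)=(S_i(x)+V_i)\cap D_i$.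 $T$ is almost w-upper semicontinuous with respect to $D$ if there exists a basis $\mathcal{B}$ of open symmetric neighborhoods of $0$ in $E$ such that, for each $V\in\mathcal{B}$, the set valued map $\overline{T^{V}}$ is upper semicontinuous. *)

theory Defs
  imports "HOL-Analysis.Analysis"
begin

text \<open>
  The type class \<open>real_normed_vector\<close> is too narrow, and a family of type-class spaces over one type would
  force all members to be the same space. A real topological vector space is therefore a topology
  \<open>E\<close> whose underlying set is a linear subspace of an ambient real vector space \<open>'e\<close>; nothing is
  assumed about a topology on \<open>'e\<close>, and different members of a family \<open>E i\<close> may have different
  underlying subspaces and unrelated topologies. This loses no generality: an arbitrary family
  of topological vector spaces is realized in this way inside the direct sum of its members.
\<close>

locale topological_vector_space =
  fixes E :: "'e::real_vector topology"
  assumes subspace_topspace: "subspace (topspace E)"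
    and continuous_map_add: "continuous_map (prod_topology E E) E (\<lambda>(x, y). x + y)"
    and continuous_map_scaleR:
      "continuous_map (prod_topology euclideanreal E) E (\<lambda>(c, x). c *\<^sub>R x)"

locale hausdorff_locally_convex_tvs = topological_vector_space +
  assumes Hausdorff: "Hausdorff_space E"
    and locally_convex: "neighbourhood_base_at 0 convex E"

definition zero_neighbourhood :: "'e::real_vector topology \<Rightarrow> 'e set \<Rightarrow> bool"
  where "zero_neighbourhood E V \<longleftrightarrow> V \<subseteq> topspace E \<and> (\<exists>U. openin E U \<and> 0 \<in> U \<and> U \<subseteq> V)"

definition symmetric_set :: "'e::real_vector set \<Rightarrow> bool"
  where "symmetric_set V \<longleftrightarrow> uminus ` V = V"

definition absolutely_convex :: "'e::real_vector set \<Rightarrow> bool"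
  where "absolutely_convex V \<longleftrightarrow> convex V \<and> (\<forall>c. \<bar>c\<bar> \<le> 1 \<longrightarrow> (\<lambda>x. c *\<^sub>R x) ` V \<subseteq> V)"

text \<open>
  A set valued map between the spaces \<open>X\<close> and \<open>Y\<close> is a function \<open>T :: 'x \<Rightarrow> 'y set\<close> of which only the
  values at points of \<open>topspace X\<close> matter.
\<close>

definition set_valued_map :: "'x set \<Rightarrow> 'y set \<Rightarrow> ('x \<Rightarrow> 'y set) \<Rightarrow> bool"
  where "set_valued_map A B T \<longleftrightarrow> (\<forall>x\<in>A. T x \<subseteq> B)"

definition graph_on :: "'x set \<Rightarrow> ('x \<Rightarrow> 'y set) \<Rightarrow> ('x \<times> 'y) set"
  where "graph_on A T = {(x, y). x \<in> A \<and> y \<in> T x}"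

definition closure_map :: "'x topology \<Rightarrow> 'y topology \<Rightarrow> ('x \<Rightarrow> 'y set) \<Rightarrow> 'x \<Rightarrow> 'y set"
  where "closure_map X Y T x =
    {y \<in> topspace Y. (x, y) \<in> prod_topology X Y closure_of graph_on (topspace X) T}"

definition upper_semicontinuous_map :: "'x topology \<Rightarrow> 'y topology \<Rightarrow> ('x \<Rightarrow> 'y set) \<Rightarrow> bool"
  where "upper_semicontinuous_map X Y T \<longleftrightarrow>
    (\<forall>x\<in>topspace X. \<forall>V. openin Y V \<and> T x \<subseteq> V \<longrightarrow>
      (\<exists>U. openin X U \<and> x \<in> U \<and> (\<forall>z\<in>U. T z \<subseteq> V)))"

text \<open>The map \<open>T\<^sup>V\<close>; the sum on the right is the Minkowski sum.\<close>

definition thicken :: "('x \<Rightarrow> 'e::real_vector set) \<Rightarrow> 'e set \<Rightarrow> 'e set \<Rightarrow> 'x \<Rightarrow> 'e set"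
  where "thicken T D V x = (T x + V) \<inter> D"

definition almost_w_upper_semicontinuous ::
    "'x topology \<Rightarrow> 'e::real_vector topology \<Rightarrow> 'e set \<Rightarrow> 'e set \<Rightarrow> ('x \<Rightarrow> 'e set) \<Rightarrow> bool"
  where "almost_w_upper_semicontinuous X E Y D T \<longleftrightarrow>
    (\<exists>\<B>. (\<forall>V\<in>\<B>. openin E V \<and> 0 \<in> V \<and> symmetric_set V) \<and>
         (\<forall>W. zero_neighbourhood E W \<longrightarrow> (\<exists>V\<in>\<B>. V \<subseteq> W)) \<and>
         (\<forall>V\<in>\<B>. upper_semicontinuous_map X (subtopology E Y)
                   (closure_map X (subtopology E Y) (thicken T D V))))"

end

theory Submission
  imports Defs
begin

text \<open>
  For an absolutely convex closed neighbourhood \<open>V\<close> of \<open>0\<close>, the map \<open>closure_map (thicken S D V)\<close> has a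
  closed graph and values in the compact set \<open>D\<close>.
  Cover the product of the \<open>D i\<close> by finitely many \<open>V\<close>-neighbourhoods of points \<open>y 0, \<dots>, y (n - 1)\<close>, in
  finitely many coordinates. The points whose image meets the \<open>V\<close>-neighbourhood of \<open>y k\<close> form a closed
  set \<open>B k\<close>, and these sets cover the product. By Brouwer's theorem some convex combination \<open>x\<close> of the
  \<open>y k\<close> lies in \<open>B k\<close> for every \<open>k\<close> of positive weight, so that \<open>x\<close> is \<open>V\<close>-close to its image, which is
  convex. Compactness yields one \<open>x\<close> that is good for all \<open>V\<close> and all coordinates \<open>i\<close> at once, and such a
  pair \<open>(x, x i)\<close> lies in the closure of the graph of \<open>S i\<close>.
\<close>

section \<open>Closed covers of a simplex\<close>

text \<open>
  The dimension has to vary inside proofs, so points of \<open>n\<close>-space are functions \<open>nat \<Rightarrow> real\<close>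
  that vanish from index \<open>n\<close> on.
\<close>

definition cube :: "nat \<Rightarrow> (nat \<Rightarrow> real) set"
  where "cube n = {x. (\<forall>i<n. 0 \<le> x i \<and> x i \<le> 1) \<and> (\<forall>i\<ge>n. x i = 0)}"

definition prob_simplex :: "nat \<Rightarrow> (nat \<Rightarrow> real) set"
  where "prob_simplex n = {x. (\<forall>i<n. 0 \<le> x i) \<and> (\<forall>i\<ge>n. x i = 0) \<and> (\<Sum>i<n. x i) = 1}"

section \<open>Brouwer's theorem on the cube\<close>

lemma compact_cube: "compact (cube n)"
proof -
  have "cube n = PiE UNIV (\<lambda>i. if i < n then {0..1} else {0})"
    by (force simp: cube_def PiE_iff split: if_splits)
  then have "compactin (product_topology (\<lambda>i. euclidean) UNIV) (cube n)"
    by (simp add: compactin_PiE)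
  then show ?thesis
    by (simp add: euclidean_product_topology compactin_euclidean_iff)
qed

lemma tendsto_fun_iff:
  fixes f :: "'b \<Rightarrow> 'a \<Rightarrow> 'c::topological_space"
  shows "(f \<longlongrightarrow> l) F \<longleftrightarrow> (\<forall>i. ((\<lambda>b. f b i) \<longlongrightarrow> l i) F)"
  using limitin_componentwise[of "\<lambda>i. euclidean" UNIV f l F]
  by (simp add: euclidean_product_topology limitin_canonical_iff)

text \<open>Kuhn's lemma finds in every grid a cell on whose corners each coordinate takes both
  labels: at one corner \<open>f\<close> does not decrease the coordinate, at another it does not
  increase it. As the mesh tends to zero, compactness of the cube gives a point where both
  inequalities hold.\<close>

lemma brouwer_fun_cube:
  fixes f :: "(nat \<Rightarrow> real) \<Rightarrow> nat \<Rightarrow> real"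
  assumes cont: "\<And>i. i < n \<Longrightarrow> continuous_on (cube n) (\<lambda>x. f x i)"
    and range: "\<And>x i. x \<in> cube n \<Longrightarrow> i < n \<Longrightarrow> 0 \<le> f x i \<and> f x i \<le> 1"
  obtains x where "x \<in> cube n" "\<And>i. i < n \<Longrightarrow> f x i = x i"
proof -
  define pt :: "nat \<Rightarrow> (nat \<Rightarrow> nat) \<Rightarrow> nat \<Rightarrow> real"
    where "pt m q = (\<lambda>i. if i < n then real (q i) / real (Suc m) else 0)" for m q
  have pt_cube: "pt m q \<in> cube n" if "\<forall>i<n. q i \<le> Suc m" for m q
    using that by (auto simp: pt_def cube_def simp flip: of_nat_Suc)
  \<comment> \<open>Label \<open>1\<close> marks a coordinate that \<open>f\<close> does not
    increase. The clause \<open>q i \<noteq> 0\<close> forces label \<open>0\<close> on the lower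
    face, as Kuhn's lemma demands; on the upper face \<open>f \<le> 1\<close> forces label
    \<open>1\<close>.\<close>
  define label :: "nat \<Rightarrow> (nat \<Rightarrow> nat) \<Rightarrow> nat \<Rightarrow> nat"
    where "label m q i = (if q i \<noteq> 0 \<and> f (pt m q) i \<le> pt m q i then 1 else 0)" for m q i
  have "\<exists>q. (\<forall>i<n. q i < Suc m) \<and>
      (\<forall>i<n. \<exists>r s. (\<forall>j<n. q j \<le> r j \<and> r j \<le> q j + 1) \<and> (\<forall>j<n. q j \<le> s j \<and> s j \<le> q j + 1)
                \<and> label m r i \<noteq> label m s i)" for m
  proof (rule kuhn_lemma[of "Suc m" n "label m"])
    show "\<forall>x. (\<forall>i<n. x i \<le> Suc m) \<longrightarrow> (\<forall>i<n. x i = Suc m \<longrightarrow> label m x i = 1)"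
    proof (intro allI impI)
      fix x i assume x: "\<forall>i<n. x i \<le> Suc m" "i < n" "x i = Suc m"
      then have "pt m x i = 1" by (simp add: pt_def)
      then show "label m x i = 1"
        using range[OF pt_cube, of x m i] x by (simp add: label_def)
    qed
    show "\<forall>x. (\<forall>i<n. x i \<le> Suc m) \<longrightarrow> (\<forall>i<n. label m x i = 0 \<or> label m x i = 1)"
      by (simp add: label_def)
    show "\<forall>x. (\<forall>i<n. x i \<le> Suc m) \<longrightarrow> (\<forall>i<n. x i = 0 \<longrightarrow> label m x i = 0)"
      by (simp add: label_def)
  next
    fix q assume "\<forall>i<n. q i < Suc m" "\<forall>i<n. \<exists>r s. (\<forall>j<n. q j \<le> r j \<and> r j \<le> q j + 1) \<and>
      (\<forall>j<n. q j \<le> s j \<and> s j \<le> q j + 1) \<and> label m r i \<noteq> label m s i"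
    then show ?thesis by (intro exI[of _ q] conjI)
  qed simp
  from choice[OF allI, OF this]
  obtain q where Q: "\<forall>m. (\<forall>i<n. q m i < Suc m) \<and>
      (\<forall>i<n. \<exists>r s. (\<forall>j<n. q m j \<le> r j \<and> r j \<le> q m j + 1) \<and>
         (\<forall>j<n. q m j \<le> s j \<and> s j \<le> q m j + 1) \<and> label m r i \<noteq> label m s i)"
    by (rule exE)
  have q: "q m i < Suc m" if "i < n" for m i
    using Q that by simp
  have rs: "\<exists>r s. (\<forall>j<n. q m j \<le> r j \<and> r j \<le> q m j + 1) \<and>
         (\<forall>j<n. q m j \<le> s j \<and> s j \<le> q m j + 1) \<and> label m r i \<noteq> label m s i"
    if "i < n" for m i
    using Q[rule_format, THEN conjunct2, rule_format, OF that] .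
  \<comment> \<open>The labels of the two corners differ and lie in \<open>{0, 1}\<close>, so either
    value is attained at one of them.\<close>
  have ex_label: "\<exists>r. \<forall>m. (\<forall>j<n. q m j \<le> r m j \<and> r m j \<le> q m j + 1) \<and> label m (r m) i = c"
    if "i < n" "c = 0 \<or> c = 1" for i c
  proof (rule choice, rule allI)
    fix m
    have "label m r i = 0 \<or> label m r i = 1" for r
      by (simp add: label_def)
    then show "\<exists>r. (\<forall>j<n. q m j \<le> r j \<and> r j \<le> q m j + 1) \<and> label m r i = c"
      using rs[OF that(1), of m] that(2) by metis
  qed
  have "pt m (q m) \<in> cube n" for m
    using q by (auto intro!: pt_cube less_imp_le)
  moreover have "seq_compact (cube n)"
    using compact_cube by (rule compact_imp_seq_compact)
  ultimately obtain x \<sigma> where x: "x \<in> cube n" and \<sigma>: "strict_mono \<sigma>"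
    and "((\<lambda>m. pt m (q m)) \<circ> \<sigma>) \<longlonglongrightarrow> x"
    by (metis seq_compactE)
  then have lim: "(\<lambda>m. pt (\<sigma> m) (q (\<sigma> m))) \<longlonglongrightarrow> x" by (simp add: comp_def)
  \<comment> \<open>Corners of the cell at \<open>q m\<close> differ from \<open>pt m (q m)\<close>
    by at most \<open>1 / Suc m\<close> in each coordinate, so every sequence of corners has the
    limit \<open>x\<close> along \<open>\<sigma>\<close>.\<close>
  have near: "(\<lambda>m. pt (\<sigma> m) (r (\<sigma> m))) \<longlonglongrightarrow> x"
    if r: "\<And>m j. j < n \<Longrightarrow> q m j \<le> r m j \<and> r m j \<le> q m j + 1" for r
  proof -
    have "(\<lambda>m. pt (\<sigma> m) (r (\<sigma> m)) j) \<longlonglongrightarrow> x j" for j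
    proof -
      have "(\<lambda>m. 1 / real (Suc m)) \<longlonglongrightarrow> 0"
        using LIMSEQ_inverse_real_of_nat by (simp add: field_simps)
      from LIMSEQ_subseq_LIMSEQ[OF this \<sigma>]
      have null: "(\<lambda>m. 1 / real (Suc (\<sigma> m))) \<longlonglongrightarrow> 0" by (simp add: comp_def)
      have le: "\<bar>pt m (r m) j - pt m (q m) j\<bar> \<le> 1 / real (Suc m)" for m
      proof (cases "j < n")
        case True
        then have "\<bar>real (r m j) - real (q m j)\<bar> \<le> 1"
          using r[of j m] by auto
        moreover have "pt m (r m) j - pt m (q m) j = (real (r m j) - real (q m j)) / real (Suc m)"
          using True by (simp add: pt_def diff_divide_distrib)
        ultimately show ?thesis
          by (simp add: abs_divide divide_right_mono)
      qed (simp add: pt_def)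
      have "(\<lambda>m. pt (\<sigma> m) (r (\<sigma> m)) j - pt (\<sigma> m) (q (\<sigma> m)) j) \<longlonglongrightarrow> 0"
        by (rule Lim_null_comparison[OF _ null]) (simp add: le del: of_nat_Suc)
      then show ?thesis
        using lim[unfolded tendsto_fun_iff, rule_format, of j] by (rule Lim_transform[rotated])
    qed
    then show ?thesis by (simp add: tendsto_fun_iff)
  qed
  have "f x i = x i" if i: "i < n" for i
  proof -
    obtain r where r: "\<And>m j. j < n \<Longrightarrow> q m j \<le> r m j \<and> r m j \<le> q m j + 1"
      and r0: "\<And>m. label m (r m) i = 0"
      using ex_label[OF i, of 0] by blast
    obtain s where s: "\<And>m j. j < n \<Longrightarrow> q m j \<le> s m j \<and> s m j \<le> q m j + 1"
      and s1: "\<And>m. label m (s m) i = 1"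
      using ex_label[OF i, of 1] by blast
    have lim_f: "(\<lambda>m. f (pt (\<sigma> m) (t (\<sigma> m))) i) \<longlonglongrightarrow> f x i"
      and in_cube: "\<And>m. pt m (t m) \<in> cube n"
      if t: "\<And>m j. j < n \<Longrightarrow> q m j \<le> t m j \<and> t m j \<le> q m j + 1" for t
    proof -
      \<comment> \<open>The bound \<open>q m j < Suc m\<close> is strict, so a corner with
        \<open>t m j \<le> q m j + 1\<close> does not leave the grid.\<close>
      show *: "pt m (t m) \<in> cube n" for m
        using t q by (intro pt_cube) (metis Suc_eq_plus1 Suc_leI le_trans less_imp_le_nat not_less_eq_eq)
      show "(\<lambda>m. f (pt (\<sigma> m) (t (\<sigma> m))) i) \<longlonglongrightarrow> f x i"
        by (rule continuous_on_tendsto_compose[OF cont[OF i] near[OF t] x]) (auto simp: *)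
    qed
    \<comment> \<open>Label \<open>0\<close> leaves two cases: \<open>f\<close> strictly increases
      the coordinate, or the coordinate is \<open>0\<close> and \<open>0 \<le> f\<close>
      suffices.\<close>
    have "pt m (r m) i \<le> f (pt m (r m)) i" for m
      using r0[of m] range[OF in_cube[OF r] i, of m] by (auto simp: label_def pt_def split: if_splits)
    then have "x i \<le> f x i"
      by (intro LIMSEQ_le[OF near[OF r, unfolded tendsto_fun_iff, rule_format] lim_f[OF r]]) auto
    moreover have "f (pt m (s m)) i \<le> pt m (s m) i" for m
      using s1[of m] by (auto simp: label_def split: if_splits)
    then have "f x i \<le> x i"
      by (intro LIMSEQ_le[OF lim_f[OF s] near[OF s, unfolded tendsto_fun_iff, rule_format]]) auto
    ultimately show ?thesis by simp
  qed
  with x show thesis using that by blast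
qed

section \<open>Retraction of the cube onto the simplex\<close>

lemma closed_simplex: "closed (prob_simplex n)"
proof -
  have c: "continuous_on UNIV (\<lambda>x :: nat \<Rightarrow> real. x i)" for i
    by simp
  have "prob_simplex n = (\<Inter>i\<in>{..<n}. {x. 0 \<le> x i}) \<inter> (\<Inter>i\<in>{n..}. {x. x i = 0}) \<inter> {x. (\<Sum>i<n. x i) = 1}"
    by (auto simp: prob_simplex_def)
  then show ?thesis
    by (auto intro!: closed_Int closed_INT closed_Collect_le closed_Collect_eq continuous_on_sum c)
qed

text \<open>A deficit of the coordinate sum below \<open>1\<close> is spread evenly, an excess above
  \<open>1\<close> is divided out; at most one correction acts. For positive \<open>n\<close> the
  numerators sum to \<open>max 1 (\<Sum>j<n. x j)\<close>, which is the denominator.\<close>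

definition cube_retraction :: "nat \<Rightarrow> (nat \<Rightarrow> real) \<Rightarrow> nat \<Rightarrow> real"
  where "cube_retraction n x = (\<lambda>i. if i < n
    then (x i + max 0 (1 - (\<Sum>j<n. x j)) / real n) / max 1 (\<Sum>j<n. x j) else 0)"

lemma cube_retraction_in_simplex:
  assumes "0 < n" "x \<in> cube n" shows "cube_retraction n x \<in> prob_simplex n"
proof -
  let ?s = "\<Sum>j<n. x j"
  have "(\<Sum>i<n. cube_retraction n x i) = (\<Sum>i<n. x i + max 0 (1 - ?s) / real n) / max 1 ?s"
    by (simp add: cube_retraction_def sum_divide_distrib)
  also have "\<dots> = (?s + max 0 (1 - ?s)) / max 1 ?s"
    using assms by (simp add: sum.distrib)
  also have "\<dots> = 1" by (auto simp: max_def)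
  finally show ?thesis
    using assms by (auto simp: prob_simplex_def cube_retraction_def cube_def intro!: divide_nonneg_pos add_nonneg_nonneg)
qed

lemma cube_retraction_id: "x \<in> prob_simplex n \<Longrightarrow> cube_retraction n x = x"
  by (auto simp: cube_retraction_def prob_simplex_def)

lemma continuous_on_cube_retraction: "continuous_on A (cube_retraction n)"
proof -
  have c: "continuous_on A (\<lambda>x :: nat \<Rightarrow> real. x i)" for i
    by (rule continuous_on_subset[OF continuous_on_product_coordinates]) simp
  have "continuous_on A (\<lambda>x. cube_retraction n x i)" for i
  proof (cases "i < n")
    case True
    have "continuous_on A (\<lambda>x. (x i + max 0 (1 - (\<Sum>j<n. x j)) / real n) / max 1 (\<Sum>j<n. x j))"
      by (intro continuous_on_divide continuous_on_add continuous_on_max continuous_on_const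
          continuous_on_diff continuous_on_sum c ballI) (use True in auto)
    then show ?thesis using True by (simp add: cube_retraction_def)
  qed (simp add: cube_retraction_def)
  then show ?thesis by (rule continuous_on_coordinatewise_then_product)
qed

text \<open>
  The self-map of the simplex is the one of Nash's existence proof: the weight of \<open>k\<close> is raised by the
  amount by which \<open>d k t\<close> lies below the average \<open>\<Sum>j. t j * d j t\<close>. At a fixed point with a positive
  raise, every \<open>k\<close> in the support of \<open>t\<close> would lie strictly below the average.
\<close>

lemma simplex_complementarity:
  fixes d :: "nat \<Rightarrow> (nat \<Rightarrow> real) \<Rightarrow> real"
  assumes n: "0 < n"
    and cont: "\<And>k. k < n \<Longrightarrow> continuous_on (prob_simplex n) (d k)"
    and nonneg: "\<And>k t. k < n \<Longrightarrow> t \<in> prob_simplex n \<Longrightarrow> 0 \<le> d k t"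
    and zero: "\<And>t. t \<in> prob_simplex n \<Longrightarrow> \<exists>k<n. d k t = 0"
  obtains t where "t \<in> prob_simplex n" "\<And>k. k < n \<Longrightarrow> t k * d k t = 0"
proof -
  define avg where "avg t = (\<Sum>j<n. t j * d j t)" for t
  define a where "a k t = max 0 (avg t - d k t)" for k t
  define A where "A t = (\<Sum>k<n. a k t)" for t
  have A0: "0 \<le> A t" for t by (auto simp: A_def a_def intro: sum_nonneg)
  have c: "continuous_on S (\<lambda>x :: nat \<Rightarrow> real. x i)" for i S
    by (rule continuous_on_subset[OF continuous_on_product_coordinates]) simp
  have cont_a: "continuous_on (prob_simplex n) (a k)" if "k < n" for k
    unfolding a_def avg_def using that by (intro continuous_intros c cont) auto
  have cont_g: "continuous_on (prob_simplex n) (\<lambda>t. (t k + a k t) / (1 + A t))" if "k < n" for k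
    using that A0 unfolding A_def
    by (intro continuous_intros c cont_a) (auto simp: add_nonneg_eq_0_iff)
  have sum_g: "(\<Sum>k<n. (t k + a k t) / (1 + A t)) = 1" if "t \<in> prob_simplex n" for t
  proof -
    have "(\<Sum>k<n. (t k + a k t) / (1 + A t)) = (1 + A t) / (1 + A t)"
      using that by (simp add: sum_divide_distrib[symmetric] sum.distrib A_def prob_simplex_def)
    also have "\<dots> = 1" using A0[of t] by simp
    finally show ?thesis .
  qed
  have g_nonneg: "0 \<le> (t k + a k t) / (1 + A t)" if "t \<in> prob_simplex n" "k < n" for t k
    using that A0[of t] by (auto simp: prob_simplex_def a_def intro!: divide_nonneg_nonneg add_nonneg_nonneg)
  \<comment> \<open>The retraction extends the self-map of the simplex to the cube, where Brouwer's
    theorem applies.\<close>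
  define f where "f x k = (cube_retraction n x k + a k (cube_retraction n x)) / (1 + A (cube_retraction n x))" for x k
  obtain x where x: "x \<in> cube n" "\<And>k. k < n \<Longrightarrow> f x k = x k"
  proof (rule brouwer_fun_cube[of n f])
    fix i assume "i < n"
    then show "continuous_on (cube n) (\<lambda>x. f x i)"
      unfolding f_def
      using continuous_on_compose2[OF cont_g continuous_on_cube_retraction[of "cube n" n]] cube_retraction_in_simplex[OF n]
      by blast
  next
    fix x i assume x: "x \<in> cube n" and i: "i < n"
    then have r: "cube_retraction n x \<in> prob_simplex n" using cube_retraction_in_simplex[OF n] by blast
    have "f x i \<le> (\<Sum>k<n. f x k)"
      using i g_nonneg[OF r] by (intro member_le_sum) (auto simp: f_def)
    then show "0 \<le> f x i \<and> f x i \<le> 1"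
      using sum_g[OF r] g_nonneg[OF r i] by (simp add: f_def)
  qed blast
  have r: "cube_retraction n x \<in> prob_simplex n" using cube_retraction_in_simplex[OF n] x by blast
  \<comment> \<open>The values of \<open>f\<close> sum to \<open>1\<close>, so the fixed point lies
    in the simplex. There the retraction is the identity, and \<open>x\<close> is fixed by the
    original self-map.\<close>
  have "x \<in> prob_simplex n"
    using sum_g[OF r] x by (auto simp: prob_simplex_def cube_def f_def)
  then have "cube_retraction n x = x" by (rule cube_retraction_id)
  have fix_eq: "x k * A x = a k x" if "k < n" for k
  proof -
    have "(x k + a k x) / (1 + A x) = x k" using x(2)[OF that] \<open>cube_retraction n x = x\<close> by (simp add: f_def)
    then show ?thesis using A0[of x] by (simp add: field_simps split: if_splits)
  qed
  have "A x = 0"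
  proof (rule ccontr)
    assume "A x \<noteq> 0"
    then have pos: "0 < A x" using A0[of x] by simp
    have lt: "d k x < avg x" if "k < n" "0 < x k" for k
    proof -
      have "0 < a k x" using fix_eq[OF that(1)] that pos by (metis mult_pos_pos)
      then show ?thesis by (simp add: a_def split: if_splits)
    qed
    have "avg x < (\<Sum>k<n. x k * avg x)"
      unfolding avg_def[of x]
    proof (rule sum_strict_mono_ex1)
      show "\<forall>k\<in>{..<n}. x k * d k x \<le> x k * (\<Sum>j<n. x j * d j x)"
      proof
        fix k assume "k \<in> {..<n}"
        then have "k < n" by simp
        with \<open>x \<in> prob_simplex n\<close> have "0 \<le> x k" by (simp add: prob_simplex_def)
        then show "x k * d k x \<le> x k * (\<Sum>j<n. x j * d j x)"
          using lt[OF \<open>k < n\<close>] by (cases "x k = 0") (auto simp: avg_def)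
      qed
      have "\<exists>k<n. 0 < x k"
      proof (rule ccontr)
        assume "\<not> (\<exists>k<n. 0 < x k)"
        then have "(\<Sum>k<n. x k) \<le> 0" by (intro sum_nonpos) (metis lessThan_iff not_less)
        with \<open>x \<in> prob_simplex n\<close> show False by (simp add: prob_simplex_def)
      qed
      then obtain k where k: "k < n" "0 < x k" by blast
      have "x k * d k x < x k * avg x" by (rule mult_strict_left_mono[OF lt[OF k] k(2)])
      then have "x k * d k x < x k * (\<Sum>j<n. x j * d j x)" by (simp only: avg_def)
      then show "\<exists>k\<in>{..<n}. x k * d k x < x k * (\<Sum>j<n. x j * d j x)"
        using k(1) by blast
    qed simp
    also have "\<dots> = avg x"
      using \<open>x \<in> prob_simplex n\<close> by (simp add: sum_distrib_right[symmetric] prob_simplex_def)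
    finally show False by simp
  qed
  \<comment> \<open>With \<open>A x = 0\<close> no weight is raised, so \<open>avg x\<close> is at
    most every \<open>d k x\<close>, in particular the vanishing one. A sum of nonnegative terms
    that is not positive has only zero terms.\<close>
  obtain k where k: "k < n" "d k x = 0" using zero \<open>x \<in> prob_simplex n\<close> by blast
  then have "avg x \<le> 0" using fix_eq[of k] \<open>A x = 0\<close> by (simp add: a_def)
  moreover have terms: "0 \<le> x j * d j x" if "j < n" for j
    using nonneg[OF that \<open>x \<in> prob_simplex n\<close>] \<open>x \<in> prob_simplex n\<close> that by (simp add: prob_simplex_def)
  moreover have "0 \<le> avg x" unfolding avg_def by (intro sum_nonneg) (simp add: terms)
  ultimately have "avg x = 0" by simp
  then have "\<forall>j\<in>{..<n}. x j * d j x = 0"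
    unfolding avg_def using terms by (subst (asm) sum_nonneg_eq_0_iff) auto
  then show thesis using that \<open>x \<in> prob_simplex n\<close> by blast
qed

text \<open>Complementarity is applied to the distances from the sets \<open>B k\<close>. A positive
  weight forces the distance to vanish, which for a closed set means membership.\<close>

lemma simplex_closed_cover:
  assumes n: "0 < n" and cl: "\<And>k. k < n \<Longrightarrow> closed (B k)"
    and cover: "prob_simplex n \<subseteq> (\<Union>k<n. B k)"
  obtains t where "t \<in> prob_simplex n" "\<forall>k<n. t k > 0 \<longrightarrow> t \<in> B k"
proof -
  \<comment> \<open>\<open>infdist t {} = 0\<close>, so an empty \<open>B k\<close> needs its own clause.\<close>
  define d where "d k t = (if B k = {} then 1 else infdist t (B k))" for k t
  have d0: "d k t = 0 \<longleftrightarrow> t \<in> B k" if "k < n" for k t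
    using in_closed_iff_infdist_zero[OF cl[OF that]] by (auto simp: d_def)
  obtain t where "t \<in> prob_simplex n" "\<And>k. k < n \<Longrightarrow> t k * d k t = 0"
  proof (rule simplex_complementarity[OF n, of d])
    show "continuous_on (prob_simplex n) (d k)" for k
      by (cases "B k = {}") (auto simp: d_def[abs_def] intro!: continuous_intros)
    show "0 \<le> d k t" for k t by (simp add: d_def infdist_nonneg)
    show "\<exists>k<n. d k t = 0" if "t \<in> prob_simplex n" for t
      using cover that d0 by blast
  qed blast
  then show thesis using that d0 by (metis less_irrefl mult_eq_0_iff)
qed

section \<open>Neighbourhoods in locally convex spaces\<close>

text \<open>Projection along a compact factor is a closed map; it is applied to the part of
  \<open>Q\<close> over \<open>K\<close>.\<close>

lemma closedin_project:
  assumes "compactin Y K" "closedin (prod_topology P Y) Q"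
  shows "closedin P {x \<in> topspace P. \<exists>z\<in>K. (x, z) \<in> Q}"
proof -
  have "compact_space (subtopology Y K)"
    using assms(1) compact_space_subtopology by blast
  then have "closed_map (prod_topology P (subtopology Y K)) P fst"
    by (rule closed_map_fst)
  moreover have "closedin (prod_topology P (subtopology Y K)) (Q \<inter> topspace P \<times> K)"
    using assms(2) unfolding prod_topology_subtopology closedin_subtopology by blast
  ultimately have "closedin P (fst ` (Q \<inter> topspace P \<times> K))"
    by (simp add: closed_map_def)
  also have "fst ` (Q \<inter> topspace P \<times> K) = {x \<in> topspace P. \<exists>z\<in>K. (x, z) \<in> Q}"
    by force
  finally show ?thesis .
qed

text \<open>Absolute convexity and symmetry bring these sets under the hypothesis on thickenings,
  convexity lets errors be averaged, and closedness makes the set of points that are close to their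
  image closed.\<close>

definition closed_disc_neighbourhood :: "'e::real_vector topology \<Rightarrow> 'e set \<Rightarrow> bool"
  where "closed_disc_neighbourhood E V \<longleftrightarrow>
    closedin E V \<and> absolutely_convex V \<and> symmetric_set V \<and> zero_neighbourhood E V"

text \<open>For \<open>\<bar>c\<bar> \<le> 1\<close> the point \<open>c *\<^sub>R x\<close> is the
  convex combination of \<open>x\<close> and \<open>- x\<close> with weights
  \<open>(1 + c) / 2\<close> and \<open>(1 - c) / 2\<close>.\<close>

lemma absolutely_convexI:
  assumes "convex V" "\<And>x. x \<in> V \<Longrightarrow> - x \<in> V"
  shows "absolutely_convex V"
  unfolding absolutely_convex_def
proof (intro conjI allI impI subsetI)
  fix c :: real and y assume c: "\<bar>c\<bar> \<le> 1" and "y \<in> (\<lambda>x. c *\<^sub>R x) ` V"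
  then obtain x where x: "x \<in> V" "y = c *\<^sub>R x" by blast
  have "((1 + c) / 2) *\<^sub>R x + ((1 - c) / 2) *\<^sub>R (- x) \<in> V"
    using c x assms by (intro convexD) (auto simp: field_simps)
  also have "((1 + c) / 2) *\<^sub>R x + ((1 - c) / 2) *\<^sub>R (- x) = (((1 + c) / 2) - ((1 - c) / 2)) *\<^sub>R x"
    by (simp only: scaleR_minus_right scaleR_diff_left) simp
  also have "\<dots> = y" by (simp add: x field_simps)
  finally show "y \<in> V" .
qed (rule assms(1))

lemma symmetric_setI: "(\<And>x. x \<in> V \<Longrightarrow> - x \<in> V) \<Longrightarrow> symmetric_set V"
  unfolding symmetric_set_def by (force intro: image_eqI[where f = uminus, OF minus_minus[symmetric]])

lemma symmetric_setD: "symmetric_set V \<Longrightarrow> x \<in> V \<Longrightarrow> - x \<in> V"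
  unfolding symmetric_set_def by blast

lemma closed_disc_neighbourhoodD:
  assumes "closed_disc_neighbourhood E V"
  shows "closedin E V" "convex V" "symmetric_set V" "zero_neighbourhood E V" "absolutely_convex V"
  using assms by (auto simp: closed_disc_neighbourhood_def absolutely_convex_def)

lemma closed_disc_neighbourhoodI:
  assumes "closedin E V" "convex V" "\<And>x. x \<in> V \<Longrightarrow> - x \<in> V" "zero_neighbourhood E V"
  shows "closed_disc_neighbourhood E V"
  using assms absolutely_convexI[of V] symmetric_setI[of V]
  by (simp add: closed_disc_neighbourhood_def)

lemma closed_disc_neighbourhood_Int:
  assumes "closed_disc_neighbourhood E V" "closed_disc_neighbourhood E W"
  shows "closed_disc_neighbourhood E (V \<inter> W)"
proof (rule closed_disc_neighbourhoodI)
  show "closedin E (V \<inter> W)" "convex (V \<inter> W)"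
    using assms by (simp_all add: closed_disc_neighbourhoodD closedin_Int convex_Int)
  show "- x \<in> V \<inter> W" if "x \<in> V \<inter> W" for x
    using that symmetric_setD[OF closed_disc_neighbourhoodD(3)[OF assms(1)], of x]
      symmetric_setD[OF closed_disc_neighbourhoodD(3)[OF assms(2)], of x] by simp
  show "zero_neighbourhood E (V \<inter> W)"
    using closed_disc_neighbourhoodD(4)[OF assms(1)] closed_disc_neighbourhoodD(4)[OF assms(2)]
    unfolding zero_neighbourhood_def by (meson IntI inf.coboundedI1 inf_mono openin_Int)
qed

context topological_vector_space
begin

section \<open>Continuity and closedness in topological vector spaces\<close>

lemma zero_mem: "0 \<in> topspace E"
  and neg_mem: "x \<in> topspace E \<Longrightarrow> - x \<in> topspace E"
  using subspace_topspace
  by (auto intro: subspace_0 subspace_neg)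

lemma continuous_map_plus:
  assumes "continuous_map Z E f" "continuous_map Z E g"
  shows "continuous_map Z E (\<lambda>z. f z + g z)"
  using continuous_map_compose[OF continuous_map_pairedI[OF assms] continuous_map_add]
  by (simp add: o_def)

lemma continuous_map_scale:
  assumes "continuous_map Z euclideanreal c" "continuous_map Z E g"
  shows "continuous_map Z E (\<lambda>z. c z *\<^sub>R g z)"
  using continuous_map_compose[OF continuous_map_pairedI[OF assms] continuous_map_scaleR]
  by (simp add: o_def)

lemma continuous_map_minus:
  assumes "continuous_map Z E f" "continuous_map Z E g"
  shows "continuous_map Z E (\<lambda>z. f z - g z)"
  using continuous_map_plus[OF assms(1) continuous_map_scale[OF _ assms(2), of "\<lambda>_. -1"]]
  by simp

lemma continuous_map_lincomb:
  assumes "finite K" "\<And>k. k \<in> K \<Longrightarrow> continuous_map Z euclideanreal (c k)"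
    "\<And>k. k \<in> K \<Longrightarrow> y k \<in> topspace E"
  shows "continuous_map Z E (\<lambda>z. \<Sum>k\<in>K. c k z *\<^sub>R y k)"
  using assms
  by (induction K rule: finite_induct)
     (auto intro!: continuous_map_plus continuous_map_scale simp: zero_mem)

lemma half_neighbourhood:
  assumes "openin E N" "0 \<in> N"
  obtains M where "openin E M" "0 \<in> M" "\<forall>x\<in>M. \<forall>y\<in>M. x + y \<in> N"
proof -
  let ?Q = "{p \<in> topspace (prod_topology E E). (case p of (x, y) \<Rightarrow> x + y) \<in> N}"
  have "openin (prod_topology E E) ?Q"
    using continuous_map_add assms(1) by (rule openin_continuous_map_preimage)
  moreover have "(0, 0) \<in> ?Q" using assms zero_mem by simp
  ultimately obtain U W where "openin E U" "openin E W" "0 \<in> U" "0 \<in> W" "U \<times> W \<subseteq> ?Q"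
    unfolding openin_prod_topology_alt by meson
  then have "openin E (U \<inter> W)" "0 \<in> U \<inter> W" "\<forall>x\<in>U \<inter> W. \<forall>y\<in>U \<inter> W. x + y \<in> N"
    by auto
  then show thesis using that by blast
qed

lemma closed_disc_neighbourhood_topspace: "closed_disc_neighbourhood E (topspace E)"
  by (rule closed_disc_neighbourhoodI)
     (auto simp: zero_neighbourhood_def zero_mem neg_mem subspace_imp_convex[OF subspace_topspace])

text \<open>The factor \<open>topspace E\<close> is the value for empty \<open>F\<close>, where
  \<open>\<Inter>F\<close> alone would be the whole ambient type.\<close>

lemma closed_disc_neighbourhood_Inter:
  assumes "finite F" "\<And>V. V \<in> F \<Longrightarrow> closed_disc_neighbourhood E V"
  shows "closed_disc_neighbourhood E (topspace E \<inter> \<Inter>F)"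
  using assms
proof (induction F rule: finite_induct)
  case (insert V F)
  then have "closed_disc_neighbourhood E (V \<inter> (topspace E \<inter> \<Inter>F))"
    by (simp add: closed_disc_neighbourhood_Int)
  moreover have "V \<inter> (topspace E \<inter> \<Inter>F) = topspace E \<inter> \<Inter>(insert V F)" by blast
  ultimately show ?case by simp
qed (simp add: closed_disc_neighbourhood_topspace)

lemma openin_translate:
  assumes "continuous_map Z E f" "openin E U" "a \<in> topspace E"
  shows "openin Z {z \<in> topspace Z. f z - a \<in> U}"
  using continuous_map_minus[OF assms(1), of "\<lambda>_. a"] assms(2,3)
  by (intro openin_continuous_map_preimage) auto

text \<open>The condition on the pair \<open>(x, z)\<close> is closed, and \<open>z\<close> can be
  projected away because it ranges over the compact \<open>K\<close>. The map \<open>g\<close> is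
  later a constant (a net point) or a coordinate projection.\<close>

lemma closedin_coincidence:
  assumes R: "closedin (prod_topology P (subtopology E A)) R"
    and K: "compactin E K" "K \<subseteq> A" and V: "closedin E V" and g: "continuous_map P E g"
  shows "closedin P {x \<in> topspace P. \<exists>z\<in>K. (x, z) \<in> R \<and> z - g x \<in> V}"
proof -
  let ?Y = "subtopology E A"
  let ?Q = "{p \<in> topspace (prod_topology P ?Y). snd p - g (fst p) \<in> V}"
  have "continuous_map (prod_topology P ?Y) E (\<lambda>p. snd p - g (fst p))"
    using continuous_map_compose[OF continuous_map_fst g]
      continuous_map_into_fulltopology[OF continuous_map_snd]
    by (intro continuous_map_minus) (auto simp: o_def)
  then have "closedin (prod_topology P ?Y) ?Q"
    using V by (rule closedin_continuous_map_preimage)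
  then have "closedin (prod_topology P ?Y) (R \<inter> ?Q)"
    using R by blast
  moreover have "compactin ?Y K" using K by (simp add: compactin_subtopology)
  ultimately have "closedin P {x \<in> topspace P. \<exists>z\<in>K. (x, z) \<in> R \<inter> ?Q}"
    by (intro closedin_project)
  moreover have "K \<subseteq> topspace ?Y" using K compactin_subset_topspace by fastforce
  then have "{x \<in> topspace P. \<exists>z\<in>K. (x, z) \<in> R \<inter> ?Q}
      = {x \<in> topspace P. \<exists>z\<in>K. (x, z) \<in> R \<and> z - g x \<in> V}"
    by auto
  ultimately show ?thesis by simp
qed

end

context hausdorff_locally_convex_tvs
begin

text \<open>A convex neighbourhood is made symmetric by intersecting it with its negative, and then
  closed. The closure of \<open>B\<close> lies in \<open>U + B\<close>, hence in
  \<open>M + M\<close>, so choosing \<open>M\<close> as half of \<open>N\<close> leaves room for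
  it.\<close>

lemma closed_disc_neighbourhood_within:
  assumes N: "openin E N" "0 \<in> N"
  obtains V where "closed_disc_neighbourhood E V" "V \<subseteq> N"
proof -
  obtain M where M: "openin E M" "0 \<in> M" "\<forall>x\<in>M. \<forall>y\<in>M. x + y \<in> N"
    by (rule half_neighbourhood[OF N])
  obtain U C where UC: "openin E U" "convex C" "0 \<in> U" "U \<subseteq> C" "C \<subseteq> M"
    using locally_convex[unfolded neighbourhood_base_at_def, rule_format, OF conjI[OF M(1,2)]] by blast
  define B where "B = C \<inter> uminus -` C"
  have B_iff: "x \<in> B \<longleftrightarrow> x \<in> C \<and> - x \<in> C" for x
    by (simp add: B_def)
  have "convex B"
  proof (rule convexI)
    fix x y and u v :: real
    assume "x \<in> B" "y \<in> B" "0 \<le> u" "0 \<le> v" "u + v = 1"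
    then have "u *\<^sub>R x + v *\<^sub>R y \<in> C" "u *\<^sub>R (- x) + v *\<^sub>R (- y) \<in> C"
      by (simp_all only: B_iff convexD[OF UC(2)])
    then show "u *\<^sub>R x + v *\<^sub>R y \<in> B" by (simp add: B_iff)
  qed
  have B_neg: "- x \<in> B" if "x \<in> B" for x using that by (simp add: B_iff)
  have B_top: "B \<subseteq> topspace E" using UC(5) openin_subset[OF M(1)] by (auto simp: B_iff)
  define V where "V = E closure_of B"
  have "V \<subseteq> N"
  proof
    fix x assume x: "x \<in> V"
    then have xt: "x \<in> topspace E" by (simp add: V_def in_closure_of)
    have "continuous_map E E (\<lambda>y. x - y)"
      using xt by (intro continuous_map_minus) auto
    then have "openin E {y \<in> topspace E. x - y \<in> U}" (is "openin E ?O")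
      using UC(1) by (rule openin_continuous_map_preimage)
    moreover have "x \<in> ?O" using xt UC(3) by simp
    moreover have "x \<in> ?O \<and> openin E ?O \<longrightarrow> (\<exists>y. y \<in> B \<and> y \<in> ?O)"
      using x unfolding V_def in_closure_of by (elim conjE allE)
    ultimately obtain y where y: "y \<in> B" "x - y \<in> U"
      by auto
    have "y \<in> M" using y(1) UC(5) by (auto simp: B_iff)
    moreover have "x - y \<in> M" using y(2) UC(4,5) by blast
    ultimately have "(x - y) + y \<in> N" using M(3) by blast
    then show "x \<in> N" by simp
  qed
  moreover have "closed_disc_neighbourhood E V"
  proof (rule closed_disc_neighbourhoodI)
    show "closedin E V" by (simp add: V_def)
    show "convex V"
    proof (rule convexI)
      fix x y and u v :: real
      assume xy: "x \<in> V" "y \<in> V" and uv: "0 \<le> u" "0 \<le> v" "u + v = 1"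
      \<comment> \<open>For fixed weights the convex combination is continuous on the product, so it
        maps the closure of \<open>B \<times> B\<close> into the closure of the image.\<close>
      let ?f = "\<lambda>p. u *\<^sub>R fst p + v *\<^sub>R snd p"
      have "continuous_map (prod_topology E E) E ?f"
        by (intro continuous_map_plus continuous_map_scale continuous_map_fst continuous_map_snd) auto
      from continuous_map_image_closure_subset[OF this, of "B \<times> B"]
      have "?f ` (V \<times> V) \<subseteq> E closure_of (?f ` (B \<times> B))"
        by (simp add: closure_of_Times V_def)
      also have "\<dots> \<subseteq> V" unfolding V_def
        using convexD[OF \<open>convex B\<close>] uv by (intro closure_of_mono) auto
      finally have "?f (x, y) \<in> V" using xy by blast
      then show "u *\<^sub>R x + v *\<^sub>R y \<in> V" by simp
    qed
    fix x assume x: "x \<in> V"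
    have "continuous_map E E (\<lambda>x. - x)"
      using continuous_map_minus[of E "\<lambda>_. 0" "\<lambda>x. x"] zero_mem by simp
    from continuous_map_image_closure_subset[OF this, of B]
    have "uminus ` V \<subseteq> E closure_of (uminus ` B)" by (simp add: V_def)
    also have "\<dots> \<subseteq> V" unfolding V_def using B_neg by (intro closure_of_mono) auto
    finally show "- x \<in> V" using x by blast
  next
    have "continuous_map E E (\<lambda>x. - x)"
      using continuous_map_minus[of E "\<lambda>_. 0" "\<lambda>x. x"] zero_mem by simp
    \<comment> \<open>\<open>U\<close> need not be symmetric; its intersection with its negative is
      an open set inside \<open>B\<close>.\<close>
    then have "openin E (U \<inter> {x \<in> topspace E. - x \<in> U})"
      using UC(1) openin_continuous_map_preimage by blast
    moreover have "U \<inter> {x \<in> topspace E. - x \<in> U} \<subseteq> B"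
      using UC(4) by (auto simp: B_iff)
    then have "U \<inter> {x \<in> topspace E. - x \<in> U} \<subseteq> V"
      using closure_of_subset[OF B_top] by (auto simp: V_def)
    moreover have "0 \<in> U \<inter> {x \<in> topspace E. - x \<in> U}" using UC(3) zero_mem by simp
    moreover have "V \<subseteq> topspace E" by (simp add: V_def closure_of_subset_topspace)
    ultimately show "zero_neighbourhood E V"
      unfolding zero_neighbourhood_def by blast
  qed
  ultimately show thesis using that by blast
qed

text \<open>Let a graph point \<open>(y, w)\<close> of the thickening approximate
  \<open>(x, z)\<close>, with \<open>w = s + v\<close>. Then
  \<open>s - a = (w - z) + (z - a) - v\<close> is a sum of three small vectors, so
  \<open>(y, s)\<close> approximates \<open>(x, a)\<close>.\<close>

lemma graph_closure_from_thickenings: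
  assumes A: "A \<subseteq> topspace E" and S: "\<And>y. y \<in> topspace P \<Longrightarrow> S y \<subseteq> A"
    and x: "x \<in> topspace P" and a: "a \<in> A"
    and near: "\<And>V. closed_disc_neighbourhood E V \<Longrightarrow>
      \<exists>z. (x, z) \<in> prod_topology P (subtopology E A) closure_of graph_on (topspace P) (thicken S D V)
        \<and> z - a \<in> V"
  shows "(x, a) \<in> prod_topology P (subtopology E A) closure_of graph_on (topspace P) S"
  unfolding in_closure_of
proof (intro conjI allI impI)
  show "(x, a) \<in> topspace (prod_topology P (subtopology E A))"
    using x a A by auto
  fix G' assume "(x, a) \<in> G' \<and> openin (prod_topology P (subtopology E A)) G'"
  then obtain U W where UW: "openin P U" "openin (subtopology E A) W" "x \<in> U" "a \<in> W" "U \<times> W \<subseteq> G'"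
    unfolding openin_prod_topology_alt by meson
  then obtain W' where W': "openin E W'" "W = W' \<inter> A" by (auto simp: openin_subtopology)
  have at: "a \<in> topspace E" using a A by blast
  let ?N = "{v \<in> topspace E. a + v \<in> W'}"
  have "continuous_map E E (\<lambda>v. a + v)" using at by (intro continuous_map_plus) auto
  then have "openin E ?N" using W'(1) by (rule openin_continuous_map_preimage)
  moreover have "0 \<in> ?N" using zero_mem UW W' by simp
  ultimately obtain M where M: "openin E M" "0 \<in> M" "\<forall>x\<in>M. \<forall>y\<in>M. x + y \<in> ?N"
    by (rule half_neighbourhood)
  \<comment> \<open>Three errors have to be added: two from \<open>M'\<close> sum to an element of
    \<open>M\<close>, the third lies in \<open>M'\<close> and so in \<open>M\<close> because
    \<open>0 \<in> M'\<close>, and sums from \<open>M\<close> stay in \<open>?N\<close>, the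
    translate of \<open>W'\<close> to the origin.\<close>
  obtain M' where M': "openin E M'" "0 \<in> M'" "\<forall>x\<in>M'. \<forall>y\<in>M'. x + y \<in> M"
    by (rule half_neighbourhood[OF M(1,2)])
  obtain V where V: "closed_disc_neighbourhood E V" "V \<subseteq> M'"
    by (rule closed_disc_neighbourhood_within[OF M'(1,2)])
  \<comment> \<open>The closed set \<open>V\<close> need not be open; \<open>G\<close> supplies the
    open set \<open>?H\<close> around \<open>z\<close>.\<close>
  obtain G where G: "openin E G" "0 \<in> G" "G \<subseteq> V"
    using closed_disc_neighbourhoodD(4)[OF V(1)] by (auto simp: zero_neighbourhood_def)
  obtain z where z: "z - a \<in> V"
    "(x, z) \<in> prod_topology P (subtopology E A) closure_of graph_on (topspace P) (thicken S D V)"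
    using near[OF V(1)] by blast
  then have zt: "z \<in> topspace E" "z \<in> A" by (auto simp: in_closure_of)
  let ?H = "{w \<in> topspace E. w - z \<in> G} \<inter> A"
  have "openin E {w \<in> topspace E. w - z \<in> G}"
    by (rule openin_translate) (use G zt in auto)
  then have "openin (subtopology E A) ?H"
    unfolding openin_subtopology by blast
  then have "openin (prod_topology P (subtopology E A)) (U \<times> ?H)"
    using UW by (simp add: openin_prod_Times_iff)
  moreover have "(x, z) \<in> U \<times> ?H" using UW zt G by simp
  ultimately have "\<exists>p. p \<in> graph_on (topspace P) (thicken S D V) \<and> p \<in> U \<times> ?H"
    using z(2)[unfolded in_closure_of, THEN conjunct2, rule_format, of "U \<times> ?H"] by simp
  then obtain y w where yw: "(y, w) \<in> graph_on (topspace P) (thicken S D V)" "y \<in> U" "w \<in> ?H"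
    by blast
  from yw(1) have y: "y \<in> topspace P" and "w \<in> S y + V"
    by (simp_all add: graph_on_def thicken_def)
  then obtain s v where s: "w = s + v" "s \<in> S y" "v \<in> V" by (auto elim: set_plus_elim)
  have "(w - z) + (z - a) \<in> M"
    using yw(3) G V z by (intro M'(3)[rule_format]) auto
  moreover have "- v \<in> M'" using symmetric_setD[OF closed_disc_neighbourhoodD(3)[OF V(1)] s(3)] V by auto
  then have "- v \<in> M" using M'(2,3) by (metis add.right_neutral)
  ultimately have "((w - z) + (z - a)) + (- v) \<in> ?N" by (rule M(3)[rule_format])
  then have "s \<in> W'" using s by (simp add: algebra_simps)
  moreover have "s \<in> A" using S y s by blast
  ultimately have "(y, s) \<in> G'" using UW W' yw by blast
  moreover have "(y, s) \<in> graph_on (topspace P) S" using y s by (simp add: graph_on_def)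
  ultimately show "\<exists>y. y \<in> graph_on (topspace P) S \<and> y \<in> G'" by blast
qed

end

section \<open>Products of locally convex spaces\<close>

locale product_setting =
  fixes I :: "'i set"
    and E :: "'i \<Rightarrow> 'e::real_vector topology"
    and X D :: "'i \<Rightarrow> 'e set"
  assumes lctvs: "\<And>i. i \<in> I \<Longrightarrow> hausdorff_locally_convex_tvs (E i)"
    and X_subset: "\<And>i. i \<in> I \<Longrightarrow> X i \<subseteq> topspace (E i)"
    and D: "\<And>i. i \<in> I \<Longrightarrow> D i \<subseteq> X i \<and> D i \<noteq> {} \<and> compactin (E i) (D i) \<and> convex (D i)"
begin

abbreviation Y :: "'i \<Rightarrow> 'e topology" where "Y i \<equiv> subtopology (E i) (X i)"

abbreviation P :: "('i \<Rightarrow> 'e) topology" where "P \<equiv> product_topology Y I"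

section \<open>Finite nets and approximate fixed points in the product\<close>

lemma tvs: "i \<in> I \<Longrightarrow> topological_vector_space (E i)"
  using lctvs hausdorff_locally_convex_tvs.axioms(1) by blast

lemma D_subset: "PiE I D \<subseteq> topspace P"
  using D X_subset by (simp add: PiE_mono Int_absorb1)

lemma compactin_D: "compactin P (PiE I D)"
  using D by (simp add: compactin_PiE compactin_subtopology)

lemma continuous_map_coordinate: "i \<in> I \<Longrightarrow> continuous_map P (E i) (\<lambda>x. x i)"
  using continuous_map_product_projection[of i I Y] by (simp add: continuous_map_in_subtopology)

lemma coordinate_mem:
  assumes "x \<in> PiE I D" "i \<in> I"
  shows "x i \<in> D i" "x i \<in> X i" "x i \<in> topspace (E i)"
  using PiE_mem[OF assms] D[OF assms(2)] X_subset[OF assms(2)] by blast+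

text \<open>The product of the \<open>D i\<close> is compact by Tychonoff's theorem, and conditions
  on finitely many coordinates define open sets. The centres of a finite subcover form the
  net.\<close>

lemma finite_net:
  assumes J: "finite J" "J \<subseteq> I" and V: "\<And>i. i \<in> J \<Longrightarrow> closed_disc_neighbourhood (E i) (V i)"
  obtains F where "finite F" "F \<subseteq> PiE I D"
    "\<forall>x\<in>PiE I D. \<exists>y\<in>F. \<forall>i\<in>J. x i - y i \<in> V i"
proof -
  have "\<forall>i\<in>J. \<exists>U. openin (E i) U \<and> 0 \<in> U \<and> U \<subseteq> V i"
    using closed_disc_neighbourhoodD(4)[OF V] by (auto simp: zero_neighbourhood_def)
  from bchoice[OF this] obtain U
    where U: "\<And>i. i \<in> J \<Longrightarrow> openin (E i) (U i) \<and> 0 \<in> U i \<and> U i \<subseteq> V i"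
    by blast
  \<comment> \<open>The factor \<open>topspace P\<close> gives the intersection the right value for
    empty \<open>J\<close>.\<close>
  define B where "B y = (\<Inter>i\<in>J. {x \<in> topspace P. x i - y i \<in> U i}) \<inter> topspace P" for y
  have "openin P (B y)" if y: "y \<in> PiE I D" for y
  proof -
    have "openin P {x \<in> topspace P. x i - y i \<in> U i}" if "i \<in> J" for i
    proof -
      have i: "i \<in> I" using that J by blast
      show ?thesis
        by (rule topological_vector_space.openin_translate[OF tvs[OF i] continuous_map_coordinate[OF i]])
           (use U[OF that] coordinate_mem[OF y i] in simp_all)
    qed
    with J(1) show ?thesis unfolding B_def by (rule openin_INT)
  qed
  moreover have "PiE I D \<subseteq> (\<Union>y\<in>PiE I D. B y)"
  proof
    fix x assume x: "x \<in> PiE I D"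
    then have "x \<in> B x" using D_subset U by (auto simp: B_def)
    with x show "x \<in> (\<Union>y\<in>PiE I D. B y)" by blast
  qed
  ultimately have "(\<forall>C\<in>B ` PiE I D. openin P C) \<and> PiE I D \<subseteq> \<Union>(B ` PiE I D)"
    by blast
  then have "\<exists>\<F>. finite \<F> \<and> \<F> \<subseteq> B ` PiE I D \<and> PiE I D \<subseteq> \<Union>\<F>"
    by (rule compactin_D[unfolded compactin_def, THEN conjunct2, THEN spec, THEN mp])
  then obtain \<F> where \<F>: "finite \<F>" "\<F> \<subseteq> B ` PiE I D" "PiE I D \<subseteq> \<Union>\<F>"
    by (elim exE conjE)
  obtain F where F: "F \<subseteq> PiE I D" "finite F" "\<F> = B ` F"
    using finite_subset_image[OF \<F>(1,2)] by (elim exE conjE)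
  have "\<forall>x\<in>PiE I D. \<exists>y\<in>F. \<forall>i\<in>J. x i - y i \<in> V i"
  proof
    fix x assume x: "x \<in> PiE I D"
    obtain y where "y \<in> F" "x \<in> B y" using F(3) \<F>(3) x by blast
    then show "\<exists>y\<in>F. \<forall>i\<in>J. x i - y i \<in> V i" using U by (force simp: B_def)
  qed
  with F(2,1) show thesis by (rule that)
qed

text \<open>Closeness of the image to a net point is a closed condition. Pulled back to the simplex
  of weights on the net, these conditions form a closed cover, and the weights found there allow
  averaging, since the fibres and the \<open>V i\<close> are convex.\<close>

lemma approximate_fixed_point:
  assumes J: "finite J" "J \<subseteq> I" and V: "\<And>i. i \<in> J \<Longrightarrow> closed_disc_neighbourhood (E i) (V i)"
    and R: "\<And>i. i \<in> J \<Longrightarrow> closedin (prod_topology P (Y i)) (R i)"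
    and fibres: "\<And>i x. i \<in> J \<Longrightarrow> x \<in> PiE I D \<Longrightarrow>
      {z. (x, z) \<in> R i} \<subseteq> D i \<and> {z. (x, z) \<in> R i} \<noteq> {} \<and> convex {z. (x, z) \<in> R i}"
  shows "\<exists>x\<in>PiE I D. \<forall>i\<in>J. \<exists>z\<in>D i. (x, z) \<in> R i \<and> z - x i \<in> V i"
proof -
  obtain F where F: "finite F" "F \<subseteq> PiE I D"
    and net: "\<forall>x\<in>PiE I D. \<exists>y\<in>F. \<forall>i\<in>J. x i - y i \<in> V i"
    by (rule finite_net[OF J V])
  obtain n :: nat and y where y: "F = y ` {k. k < n}"
    using finite_imp_nat_seg_image_inj_on[OF F(1)] by (elim exE conjE)
  have yD: "y k i \<in> D i" if "k < n" "i \<in> I" for k i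
    using F(2) y that by (blast dest: PiE_mem)
  have "PiE I D \<noteq> {}" using D by (simp add: PiE_eq_empty_iff)
  then have n: "0 < n" using net y by fastforce
  \<comment> \<open>The image point \<open>z\<close> may depend on \<open>i\<close>, so membership
    is a conjunction of one closed condition for each coordinate in \<open>J\<close>.\<close>
  define B where "B k = topspace P \<inter>
    (\<Inter>i\<in>J. {x \<in> topspace P. \<exists>z\<in>D i. (x, z) \<in> R i \<and> z - y k i \<in> V i})" for k
  have B_closed: "closedin P (B k)" if k: "k < n" for k
  proof -
    have "closedin P {x \<in> topspace P. \<exists>z\<in>D i. (x, z) \<in> R i \<and> z - y k i \<in> V i}" if "i \<in> J" for i
    proof -
      have i: "i \<in> I" using that J by blast
      show ?thesis
        using topological_vector_space.closedin_coincidence[OF tvs[OF i] R[OF that] _ _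
            closed_disc_neighbourhoodD(1)[OF V[OF that]], of "D i" "\<lambda>_. y k i"]
          D[OF i] X_subset[OF i] yD[OF k i] by auto
    qed
    then have "closedin P (\<Inter>(insert (topspace P)
        ((\<lambda>i. {x \<in> topspace P. \<exists>z\<in>D i. (x, z) \<in> R i \<and> z - y k i \<in> V i}) ` J)))"
      by (intro closedin_Inter) (blast intro: closedin_topspace)+
    then show ?thesis by (simp only: B_def Inter_insert)
  qed
  have B_cover: "\<exists>k<n. x \<in> B k" if x: "x \<in> PiE I D" for x
  proof -
    have "\<exists>z. \<forall>i\<in>J. (x, z i) \<in> R i"
      using fibres[OF _ x] by (intro bchoice) blast
    then obtain z where z: "\<And>i. i \<in> J \<Longrightarrow> (x, z i) \<in> R i" by blast
    then have zD: "z i \<in> D i" if "i \<in> J" for i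
      using fibres[OF that x] that by blast
    \<comment> \<open>Putting image points into the \<open>J\<close>-coordinates of \<open>x\<close>
      gives a point of the product. A net point close to \<open>w\<close> is then close to every
      \<open>z i\<close>.\<close>
    define w where "w = restrict (\<lambda>i. if i \<in> J then z i else x i) I"
    have "w \<in> PiE I D" using x zD by (auto simp: w_def)
    then obtain k where k: "k < n" "\<forall>i\<in>J. w i - y k i \<in> V i"
      using net y by blast
    have "z i - y k i \<in> V i" if "i \<in> J" for i
      using bspec[OF k(2) that] subsetD[OF J(2) that] that by (simp add: w_def)
    then have "x \<in> B k" using z zD x D_subset by (auto simp: B_def)
    with k show ?thesis by blast
  qed
  define h where "h t = restrict (\<lambda>i. \<Sum>k<n. t k *\<^sub>R y k i) I" for t :: "nat \<Rightarrow> real"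
  have hD: "h t \<in> PiE I D" if "t \<in> prob_simplex n" for t
    using that yD D by (auto simp: h_def prob_simplex_def intro!: convex_sum)
  have coord: "continuous_map (top_of_set (prob_simplex n)) euclideanreal (\<lambda>t. t k)" for k
    by (simp add: continuous_on_subset[OF continuous_on_product_coordinates])
  have h_cont: "continuous_map (top_of_set (prob_simplex n)) P h"
  proof -
    have "continuous_map (top_of_set (prob_simplex n)) (Y i) (\<lambda>t. h t i)" if "i \<in> I" for i
    proof -
      have "continuous_map (top_of_set (prob_simplex n)) (E i) (\<lambda>t. \<Sum>k<n. t k *\<^sub>R y k i)"
        using yD D X_subset that
        by (intro topological_vector_space.continuous_map_lincomb[OF tvs[OF that]] coord) blast+
      then have "continuous_map (top_of_set (prob_simplex n)) (E i) (\<lambda>t. h t i)"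
        using that by (simp add: h_def)
      moreover have "h t i \<in> X i" if "t \<in> prob_simplex n" for t
        using hD[OF that] D \<open>i \<in> I\<close> by (blast dest: PiE_mem)
      ultimately show ?thesis
        by (auto simp: continuous_map_in_subtopology)
    qed
    then show ?thesis
      by (auto simp: continuous_map_componentwise h_def)
  qed
  define C where "C k = {t \<in> prob_simplex n. h t \<in> B k}" for k
  have C_closed: "closed (C k)" if "k < n" for k
  proof -
    have "closedin (top_of_set (prob_simplex n)) (C k)"
      using closedin_continuous_map_preimage[OF h_cont B_closed[OF that]] by (simp add: C_def)
    then show ?thesis using closed_simplex closedin_closed_trans by blast
  qed
  have "prob_simplex n \<subseteq> (\<Union>k<n. C k)"
    using B_cover hD by (fastforce simp: C_def)
  with n C_closed obtain t where t: "t \<in> prob_simplex n" "\<forall>k<n. t k > 0 \<longrightarrow> t \<in> C k"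
    by (rule simplex_closed_cover)
  have "\<forall>i\<in>J. \<exists>z\<in>D i. (h t, z) \<in> R i \<and> z - h t i \<in> V i"
  proof
    fix i assume i: "i \<in> J"
    \<comment> \<open>Membership in \<open>B k\<close> is known for positive weights only, so the
      sums are cut down to the support.\<close>
    define K where "K = {k. k < n \<and> t k > 0}"
    have K: "finite K" "K \<subseteq> {..<n}" by (auto simp: K_def)
    have vanish: "t k = 0" if "k \<in> {..<n} - K" for k
      using that t(1) by (force simp: K_def prob_simplex_def)
    have sum_K: "(\<Sum>k\<in>K. t k) = 1"
      using t(1) vanish K sum.mono_neutral_left[of "{..<n}" K t] by (simp add: prob_simplex_def)
    have hi: "h t i = (\<Sum>k\<in>K. t k *\<^sub>R y k i)"
      using i J vanish K sum.mono_neutral_left[of "{..<n}" K "\<lambda>k. t k *\<^sub>R y k i"]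
      by (auto simp: h_def)
    have "\<exists>z. \<forall>k\<in>K. (h t, z k) \<in> R i \<and> z k - y k i \<in> V i"
    proof (rule bchoice, rule ballI)
      fix k assume "k \<in> K"
      then have "h t \<in> B k" using t(2) by (auto simp: K_def C_def)
      then show "\<exists>z. (h t, z) \<in> R i \<and> z - y k i \<in> V i" using i by (auto simp: B_def)
    qed
    then obtain z where z: "\<And>k. k \<in> K \<Longrightarrow> (h t, z k) \<in> R i" "\<And>k. k \<in> K \<Longrightarrow> z k - y k i \<in> V i"
      by blast
    have pos: "0 \<le> t k" if "k \<in> K" for k using that by (simp add: K_def)
    \<comment> \<open>Image points and net points are averaged with the same weights: the mean of
      the \<open>z k\<close> stays in the convex fibre, and its difference from \<open>h t i\<close>
      is a mean of vectors of the convex \<open>V i\<close>.\<close>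
    have "(\<Sum>k\<in>K. t k *\<^sub>R z k) \<in> {z. (h t, z) \<in> R i}"
      using fibres[OF i hD[OF t(1)]] z(1) by (intro convex_sum K(1) sum_K pos) auto
    moreover have "(\<Sum>k\<in>K. t k *\<^sub>R (z k - y k i)) \<in> V i"
      using closed_disc_neighbourhoodD(2)[OF V[OF i]] z(2) by (intro convex_sum K(1) sum_K pos)
    then have "(\<Sum>k\<in>K. t k *\<^sub>R z k) - h t i \<in> V i"
      by (simp add: hi scaleR_diff_right sum_subtractf)
    ultimately show "\<exists>z\<in>D i. (h t, z) \<in> R i \<and> z - h t i \<in> V i"
      using fibres[OF i hD[OF t(1)]] by blast
  qed
  then show ?thesis using hD[OF t(1)] by (intro bexI[of _ "h t"])
qed

section \<open>One point for all coordinates and neighbourhoods\<close>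

lemma thickening_closure_subset:
  assumes "i \<in> I"
  shows "prod_topology P (Y i) closure_of graph_on (topspace P) (thicken S (D i) V)
    \<subseteq> topspace P \<times> D i"
proof (rule closure_of_minimal)
  interpret hausdorff_locally_convex_tvs "E i" using lctvs assms .
  \<comment> \<open>Compact sets in a Hausdorff space are closed, so closing the graph adds no
    values outside \<open>D i\<close>.\<close>
  have "closedin (Y i) (D i)"
    using D[OF assms] Hausdorff
    by (intro compactin_imp_closedin Hausdorff_space_subtopology) (auto simp: compactin_subtopology)
  then show "closedin (prod_topology P (Y i)) (topspace P \<times> D i)"
    by (subst closedin_prod_Times_iff) (blast intro: closedin_topspace)
qed (auto simp: graph_on_def thicken_def)

text \<open>Each pair of a coordinate and a neighbourhood imposes a closed condition on points of
  the compact product. Finitely many of them hold at an approximate fixed point, so the finite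
  intersection property gives a point satisfying all.\<close>

lemma exists_point_in_graph_closures:
  assumes S: "\<And>i x. i \<in> I \<Longrightarrow> x \<in> topspace P \<Longrightarrow> S i x \<subseteq> X i"
    and fibres: "\<And>i V x. i \<in> I \<Longrightarrow> closed_disc_neighbourhood (E i) V \<Longrightarrow> x \<in> topspace P \<Longrightarrow>
      closure_map P (Y i) (thicken (S i) (D i) V) x \<noteq> {} \<and>
      convex (closure_map P (Y i) (thicken (S i) (D i) V) x)"
  shows "\<exists>x\<in>PiE I D. \<forall>i\<in>I. x i \<in> closure_map P (Y i) (S i) x"
proof -
  define R where "R i V = prod_topology P (Y i) closure_of graph_on (topspace P) (thicken (S i) (D i) V)" for i V
  have R_closed: "closedin (prod_topology P (Y i)) (R i V)" for i V
    by (simp add: R_def)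
  have R_subset: "R i V \<subseteq> topspace P \<times> D i" if "i \<in> I" for i V
    using thickening_closure_subset[OF that] by (simp add: R_def)
  have R_values: "{z. (x, z) \<in> R i V} = closure_map P (Y i) (thicken (S i) (D i) V) x" if "i \<in> I" for i V x
    using R_subset[OF that, of V] D[OF that] X_subset[OF that] by (auto simp: closure_map_def R_def)
  define A where "A = (\<lambda>(i, V). {x \<in> topspace P. \<exists>z\<in>D i. (x, z) \<in> R i V \<and> z - x i \<in> V})"
  define Q where "Q = {(i, V). i \<in> I \<and> closed_disc_neighbourhood (E i) V}"
  have A_closed: "closedin P C" if C: "C \<in> A ` Q" for C
  proof -
    obtain i V where iV: "i \<in> I" "closed_disc_neighbourhood (E i) V" "C = A (i, V)"
      using C by (auto simp: Q_def)
    show ?thesis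
      unfolding iV(3) A_def prod.case
      using topological_vector_space.closedin_coincidence[OF tvs[OF iV(1)] R_closed _ _
          closed_disc_neighbourhoodD(1)[OF iV(2)] continuous_map_coordinate[OF iV(1)]] D[OF iV(1)] by blast
  qed
  have "PiE I D \<inter> \<Inter>\<F> \<noteq> {}" if \<F>: "finite \<F>" "\<F> \<subseteq> A ` Q" for \<F>
  proof -
    obtain N where N: "N \<subseteq> Q" "finite N" "\<F> = A ` N"
      using finite_subset_image[OF \<F>] by (elim exE conjE)
    \<comment> \<open>A single \<open>V i\<close> lies inside every \<open>W\<close> listed with
      \<open>i\<close>. Thickening is monotone in the neighbourhood, so a point that is good for
      \<open>V i\<close> is good for each such \<open>W\<close>.\<close>
    define V where "V i = topspace (E i) \<inter> \<Inter>{W. (i, W) \<in> N}" for i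
    have V: "closed_disc_neighbourhood (E i) (V i)" if "i \<in> I" for i
    proof -
      have "finite {W. (i, W) \<in> N}"
        by (rule finite_subset[OF _ finite_imageI[OF N(2), of snd]]) force
      then show ?thesis unfolding V_def using N(1)
        by (intro topological_vector_space.closed_disc_neighbourhood_Inter[OF tvs[OF that]])
           (auto simp: Q_def)
    qed
    have J: "finite (fst ` N)" "fst ` N \<subseteq> I" using N by (auto simp: Q_def)
    have "\<exists>x\<in>PiE I D. \<forall>i\<in>fst ` N. \<exists>z\<in>D i. (x, z) \<in> R i (V i) \<and> z - x i \<in> V i"
    proof (rule approximate_fixed_point[OF J])
      fix i x assume "i \<in> fst ` N" and x: "x \<in> PiE I D"
      then have i: "i \<in> I" using J by blast
      show "{z. (x, z) \<in> R i (V i)} \<subseteq> D i \<and> {z. (x, z) \<in> R i (V i)} \<noteq> {} \<and>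
          convex {z. (x, z) \<in> R i (V i)}"
        using R_subset[OF i] fibres[OF i V[OF i], of x] D_subset x
        unfolding R_values[OF i, symmetric] by blast
    qed (use J V R_closed in auto)
    then obtain x where x: "x \<in> PiE I D"
      "\<forall>i\<in>fst ` N. \<exists>z\<in>D i. (x, z) \<in> R i (V i) \<and> z - x i \<in> V i"
      by blast
    have "x \<in> A (i, W)" if iW: "(i, W) \<in> N" for i W
    proof -
      have "i \<in> fst ` N" using iW by force
      then obtain z where z: "z \<in> D i" "(x, z) \<in> R i (V i)" "z - x i \<in> V i" using x(2) by blast
      have "V i \<subseteq> W" using iW by (auto simp: V_def)
      then have "thicken (S i) (D i) (V i) y \<subseteq> thicken (S i) (D i) W y" for y
        unfolding thicken_def by (intro Int_mono set_plus_mono2) auto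
      then have "R i (V i) \<subseteq> R i W"
        unfolding R_def by (intro closure_of_mono) (auto simp: graph_on_def)
      then show ?thesis using z \<open>V i \<subseteq> W\<close> x(1) D_subset by (auto simp: A_def)
    qed
    then show ?thesis using x(1) unfolding N(3) by auto
  qed
  then have "PiE I D \<inter> \<Inter>(A ` Q) \<noteq> {}"
    using A_closed
    by (intro compactin_D[unfolded compactin_fip, THEN conjunct2, THEN spec, THEN mp]) simp
  then obtain x where x: "x \<in> PiE I D" "\<forall>q\<in>Q. x \<in> A q" by blast
  have "\<forall>i\<in>I. x i \<in> closure_map P (Y i) (S i) x"
  proof
    fix i assume i: "i \<in> I"
    interpret hausdorff_locally_convex_tvs "E i" using lctvs i .
    note xi = coordinate_mem[OF x(1) i]
    have "(x, x i) \<in> prod_topology P (Y i) closure_of graph_on (topspace P) (S i)"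
    proof (rule graph_closure_from_thickenings[OF X_subset[OF i] S[OF i] _ xi(2)])
      show "x \<in> topspace P" using x(1) D_subset by blast
      fix V assume "closed_disc_neighbourhood (E i) V"
      then have "x \<in> A (i, V)" using x(2) i by (simp add: Q_def)
      then show "\<exists>z. (x, z) \<in> prod_topology P (Y i) closure_of
          graph_on (topspace P) (thicken (S i) (D i) V) \<and> z - x i \<in> V"
        by (auto simp: A_def R_def)
    qed
    then show "x i \<in> closure_map P (Y i) (S i) x" using xi by (simp add: closure_map_def)
  qed
  then show ?thesis using x(1) by (intro bexI[of _ x])
qed

end

theorem theorem3p1:
  fixes I :: "'i set"
    and E :: "'i \<Rightarrow> 'e::real_vector topology"
    and X D :: "'i \<Rightarrow> 'e set"
    and S T :: "'i \<Rightarrow> ('i \<Rightarrow> 'e) \<Rightarrow> 'e set"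
    and PX :: "('i \<Rightarrow> 'e) topology"
  defines "PX \<equiv> product_topology (\<lambda>i. subtopology (E i) (X i)) I"
  assumes "\<And>i. i \<in> I \<Longrightarrow> hausdorff_locally_convex_tvs (E i)"
    and "\<And>i. i \<in> I \<Longrightarrow> X i \<subseteq> topspace (E i) \<and> X i \<noteq> {} \<and> convex (X i)"
    and "\<And>i. i \<in> I \<Longrightarrow> D i \<subseteq> X i \<and> D i \<noteq> {} \<and> compactin (E i) (D i) \<and> convex (D i)"
    and "\<And>i. i \<in> I \<Longrightarrow> set_valued_map (topspace PX) (X i) (S i)"
    and "\<And>i. i \<in> I \<Longrightarrow> set_valued_map (topspace PX) (X i) (T i)"
    and "\<And>i x. i \<in> I \<Longrightarrow> x \<in> topspace PX \<Longrightarrow>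
           closure_map PX (subtopology (E i) (X i)) (S i) x \<subseteq> T i x"
    and "\<And>i. i \<in> I \<Longrightarrow> almost_w_upper_semicontinuous PX (E i) (X i) (D i) (S i)"
    and "\<And>i V x. i \<in> I \<Longrightarrow> zero_neighbourhood (E i) V \<Longrightarrow> absolutely_convex V \<Longrightarrow>
           symmetric_set V \<Longrightarrow> x \<in> topspace PX \<Longrightarrow>
           closure_map PX (subtopology (E i) (X i)) (thicken (S i) (D i) V) x \<noteq> {} \<and>
           convex (closure_map PX (subtopology (E i) (X i)) (thicken (S i) (D i) V) x)"
  shows "\<exists>x\<in>PiE I D. \<forall>i\<in>I. x i \<in> T i x"
proof -
  interpret product_setting I E X D
    by (rule product_setting.intro) (simp_all add: assms(2-4))
  have S: "S i x \<subseteq> X i" if "i \<in> I" "x \<in> topspace P" for i x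
    using assms(5)[OF that(1)] that(2) by (simp add: set_valued_map_def PX_def)
  \<comment> \<open>Closed disc neighbourhoods are absolutely convex symmetric neighbourhoods of
    \<open>0\<close>, so the hypothesis on the values of the closed thickenings covers them.\<close>
  note fibres = assms(9)[OF _ closed_disc_neighbourhoodD(4,5,3), unfolded PX_def]
  obtain x where x: "x \<in> PiE I D" "\<forall>i\<in>I. x i \<in> closure_map P (Y i) (S i) x"
    using exists_point_in_graph_closures[OF S fibres] by (rule bexE)
  have "x \<in> topspace PX" using x(1) D_subset unfolding PX_def by (rule rev_subsetD)
  then have "x i \<in> T i x" if "i \<in> I" for i
    using subsetD[OF assms(7)[OF that, unfolded PX_def] bspec[OF x(2) that]] by (simp only: PX_def)
  then show ?thesis using x(1) by (intro bexI[of _ x] ballI)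
qed

end
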